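(* Let $\gamma>0$. Let $\hat{\mathbf S}$ and $\mathbf W$ be symmetric positive definite matrices that are spectrally equivalent to the Schur complement $\mathbf S=\mathbf B\mathbf A^{-1}\mathbf B^T$, i.e. $$c_\mu \hat{\mathbf S}\le \mathbf S\le C_\mu\hat{\mathbf S},\qquad d_\mu\mathbf W\le\mathbf S\le D_\mu\mathbf W,\qquad e_\mu\mathbf W\le\hat{\mathbf S}\le E_\mu\mathbf W,$$ with mesh-independent constants $c_\mu,C_\mu,d_\mu,D_\mu,e_\mu,E_\mu>0$. Let $\mathbf S_\gamma=\mathbf B(\mathbf A+\gamma\mathbf B^T\mathbf W^{-1}\mathbf B)^{-1}\mathbf B^T$ be the Schur complement of the augmented system. Then $\hat{\mathbf S}_\gamma:=(\hat{\mathbf S}^{-1}+\gamma\mathbf W^{-1})^{-1}$ is spectrally equivalent to $\mathbf S_\gamma$ (with mesh-independent constants), and the spectrum satisfies $\sigma(\hat{\mathbf S}_\gamma^{-1}\mathbf S_\gamma)\subset[f_\mu,F_\mu]$, where $$f_\mu:=\max\left(\frac{c_\mu}{1+\gamma c_\mu E_\mu}+\frac{\gamma d_\mu}{1+\gamma d_\mu}\,,\ \frac{1+\gamma e_\mu}{\max(1,c_\mu^{-1})+\gamma e_\mu}\right),$$ $$F_\mu:=\min\left(\frac{C_\mu}{1+\gamma C_\mu e_\mu}+\frac{\gamma D_\mu}{1+\gamma D_\mu}\,,\ \frac{1+\gamma e_\mu}{\min(1,C_\mu^{-1})+\gamma e_\mu}\right).$$ Moreover, $f_\mu\to1$ and $F_\mu\to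 1$ as $\gamma\to\infty$.
   Context: $\mathbf A\in\mathbb R^{n\times n}$ is symmetric positive definite (the discrete viscous stress operator of a Stokes problem with viscosity $\mu$) and $\mathbf B\in\mathbb R^{m\times n}$ is the discrete divergence operator, of full row rank, so that $\mathbf S=\mathbf B\mathbf A^{-1}\mathbf B^T\in\mathbb R^{m\times m}$ is symmetric positive definite; $\hat{\mathbf S},\mathbf W\in\mathbb R^{m\times m}$. For symmetric positive definite matrices, $\mathbf X\le\mathbf Y$ means $\mathbf x^T\mathbf X\mathbf x\le\mathbf x^T\mathbf Y\mathbf x$ for all vectors $\mathbf x$. All matrices come from a family of discretizations indexed by the mesh; "mesh-independent" means the constants can be chosen the same for all members of the family (they may depend on $\mu$). Two symmetric positive definite (families of) matrices $\mathbf X,\mathbf Y$ are spectrally equivalent if $c\mathbf X\le\mathbf Y\le C\mathbf X$ with mesh-independent constants $c,C>0$. *)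

theory Defs
  imports
    Jordan_Normal_Form.Gauss_Jordan_Elimination
    Jordan_Normal_Form.DL_Rank
    Jordan_Normal_Form.Spectral_Radius
begin

definition spd :: "real mat \<Rightarrow> bool" where
  "spd X \<longleftrightarrow> square_mat X \<and> X\<^sup>T = X \<and>
     (\<forall>x \<in> carrier_vec (dim_row X). x \<noteq> 0\<^sub>v (dim_row X) \<longrightarrow> 0 < x \<bullet> (X *\<^sub>v x))"

definition loewner_le :: "real mat \<Rightarrow> real mat \<Rightarrow> bool"  (infix "\<preceq>" 50) where
  "X \<preceq> Y \<longleftrightarrow> (\<exists>k. X \<in> carrier_mat k k \<and> Y \<in> carrier_mat k k \<and>
     (\<forall>x \<in> carrier_vec k. x \<bullet> (X *\<^sub>v x) \<le> x \<bullet> (Y *\<^sub>v x)))"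

(* 'h indexes the discretizations (meshes); the sizes of the matrices may vary with h.
   Mesh independence is the order of the quantifiers: the constants precede h. *)
definition spectrally_equivalent :: "('h \<Rightarrow> real mat) \<Rightarrow> ('h \<Rightarrow> real mat) \<Rightarrow> bool" where
  "spectrally_equivalent X Y \<longleftrightarrow> (\<forall>h. spd (X h) \<and> spd (Y h)) \<and>
     (\<exists>c>0. \<exists>C>0. \<forall>h. c \<cdot>\<^sub>m X h \<preceq> Y h \<and> Y h \<preceq> C \<cdot>\<^sub>m X h)"

(* Unspecified if X is not invertible. *)
definition minv :: "real mat \<Rightarrow> real mat" where
  "minv X = the (mat_inverse X)"

definition schur :: "real mat \<Rightarrow> real mat \<Rightarrow> real mat" where
  "schur A B = B * minv A * B\<^sup>T"

definition augmented :: "real \<Rightarrow> real mat \<Rightarrow> real mat \<Rightarrow> real mat \<Rightarrow> real mat" where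
  "augmented \<gamma> A B W = A + \<gamma> \<cdot>\<^sub>m (B\<^sup>T * minv W * B)"

definition schur_precond :: "real \<Rightarrow> real mat \<Rightarrow> real mat \<Rightarrow> real mat" where
  "schur_precond \<gamma> Shat W = minv (minv Shat + \<gamma> \<cdot>\<^sub>m minv W)"

(* A real matrix that is not symmetric may have non-real eigenvalues, so the spectrum
   is taken over the complex numbers. *)
definition cspectrum :: "real mat \<Rightarrow> complex set" where
  "cspectrum X = spectrum (map_mat complex_of_real X)"

definition f_low :: "real \<Rightarrow> real \<Rightarrow> real \<Rightarrow> real \<Rightarrow> real \<Rightarrow> real" where
  "f_low c d e E \<gamma> = max (c / (1 + \<gamma> * c * E) + \<gamma> * d / (1 + \<gamma> * d))
                         ((1 + \<gamma> * e) / (max 1 (inverse c) + \<gamma> * e))"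

definition F_up :: "real \<Rightarrow> real \<Rightarrow> real \<Rightarrow> real \<Rightarrow> real" where
  "F_up C D e \<gamma> = min (C / (1 + \<gamma> * C * e) + \<gamma> * D / (1 + \<gamma> * D))
                      ((1 + \<gamma> * e) / (min 1 (inverse C) + \<gamma> * e))"

end

theory Submission
  imports Defs "HOL-Real_Asymp.Real_Asymp"
begin

text \<open>
  The augmented Schur complement has the inverse \<open>S\<inverse> + \<gamma> W\<inverse>\<close>. Since inversion reverses the
  Loewner order, the claim compares \<open>P = Shat\<inverse> + \<gamma> W\<inverse>\<close> with \<open>Q = S\<inverse> + \<gamma> W\<inverse>\<close>. With \<open>s\<close>, \<open>t\<close>, \<open>w\<close>
  the values at a vector of the quadratic forms of \<open>S\<inverse>\<close>, \<open>Shat\<inverse>\<close>, \<open>W\<inverse>\<close>, this amounts to bounding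
  the quotient \<open>(t + \<gamma> w) / (s + \<gamma> w)\<close> under \<open>c s \<le> t \<le> C s\<close>, \<open>d s \<le> w \<le> D s\<close>, \<open>e t \<le> w \<le> E t\<close>.
  The first bounds come from splitting the numerator; the second ones from replacing \<open>s\<close> by a multiple
  of \<open>t\<close>, after which the quotient is monotone in \<open>w / t\<close>.
\<close>

section \<open>Symmetric positive definite matrices\<close>

lemma spdD_pos:
  assumes "spd X" "X \<in> carrier_mat k k" "x \<in> carrier_vec k" "x \<noteq> 0\<^sub>v k"
  shows "0 < x \<bullet> (X *\<^sub>v x)"
  using assms by (auto simp: spd_def)

lemma spdD_nonneg:
  assumes "spd X" "X \<in> carrier_mat k k" "x \<in> carrier_vec k"
  shows "0 \<le> x \<bullet> (X *\<^sub>v x)"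
proof (cases "x = 0\<^sub>v k")
  case True
  then show ?thesis using assms(2) by simp
next
  case False
  then show ?thesis using spdD_pos[OF assms] by simp
qed

lemma spdI:
  assumes "X \<in> carrier_mat k k" "X\<^sup>T = X"
    and "\<And>x. x \<in> carrier_vec k \<Longrightarrow> x \<noteq> 0\<^sub>v k \<Longrightarrow> 0 < x \<bullet> (X *\<^sub>v x)"
  shows "spd X"
  using assms by (auto simp: spd_def)

section \<open>Quadratic forms and symmetry\<close>

lemma symmetric_scalar_prod_swap:
  fixes X :: "real mat"
  assumes "X \<in> carrier_mat k k" "X\<^sup>T = X" "x \<in> carrier_vec k" "y \<in> carrier_vec k"
  shows "x \<bullet> (X *\<^sub>v y) = y \<bullet> (X *\<^sub>v x)"
  using transpose_vec_mult_scalar[OF assms(1) assms(4,3)] assms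
  by (metis comm_scalar_prod mult_mat_vec_carrier)

lemma smult_mat_quadratic_form:
  fixes X :: "real mat"
  assumes X: "X \<in> carrier_mat k k" and x: "x \<in> carrier_vec k"
  shows "x \<bullet> ((a \<cdot>\<^sub>m X) *\<^sub>v x) = a * (x \<bullet> (X *\<^sub>v x))"
proof -
  have "(a \<cdot>\<^sub>m X) *\<^sub>v x = a \<cdot>\<^sub>v (X *\<^sub>v x)"
    using X x by (intro eq_vecI) auto
  then show ?thesis using X x by simp
qed

lemma add_mat_quadratic_form:
  fixes X Y :: "real mat"
  assumes "X \<in> carrier_mat k k" "Y \<in> carrier_mat k k" "x \<in> carrier_vec k"
  shows "x \<bullet> ((X + Y) *\<^sub>v x) = x \<bullet> (X *\<^sub>v x) + x \<bullet> (Y *\<^sub>v x)"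
  using assms by (simp add: add_mult_distrib_mat_vec scalar_prod_add_distrib[of _ k])

text \<open>This is how the sign of the form of \<open>minv W\<close> carries over to the
  augmentation term \<open>B\<^sup>T * minv W * B\<close>.\<close>

lemma congruence_quadratic_form:
  fixes X B :: "real mat"
  assumes X: "X \<in> carrier_mat k k" and B: "B \<in> carrier_mat k l" and x: "x \<in> carrier_vec l"
  shows "x \<bullet> ((B\<^sup>T * X * B) *\<^sub>v x) = (B *\<^sub>v x) \<bullet> (X *\<^sub>v (B *\<^sub>v x))"
proof -
  let ?y = "X *\<^sub>v (B *\<^sub>v x)"
  have y: "?y \<in> carrier_vec k" using X B x by auto
  have "(B\<^sup>T * X * B) *\<^sub>v x = B\<^sup>T *\<^sub>v ?y"
    using X B x by (simp add: assoc_mult_mat_vec[of _ l k _ l] assoc_mult_mat_vec[of _ l k _ k])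
  then have "x \<bullet> ((B\<^sup>T * X * B) *\<^sub>v x) = (B\<^sup>T *\<^sub>v ?y) \<bullet> x"
    using B x y by (simp add: comm_scalar_prod[of x l])
  also have "\<dots> = ?y \<bullet> (B *\<^sub>v x)"
    by (rule transpose_vec_mult_scalar[OF B x y])
  also have "\<dots> = (B *\<^sub>v x) \<bullet> ?y"
    using B x y by (simp add: comm_scalar_prod[of _ k])
  finally show ?thesis .
qed

lemma congruence_symmetric:
  fixes X B :: "real mat"
  assumes X: "X \<in> carrier_mat k k" "X\<^sup>T = X" and B: "B \<in> carrier_mat k l"
  shows "(B\<^sup>T * X * B)\<^sup>T = B\<^sup>T * X * B"
proof -
  have XB: "X * B \<in> carrier_mat k l" using X B by simp
  have "(B\<^sup>T * (X * B))\<^sup>T = (X * B)\<^sup>T * B"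
    using B XB by (simp add: transpose_mult[of _ l k _ l])
  also have "(X * B)\<^sup>T = B\<^sup>T * X"
    using X B by (simp add: transpose_mult[of _ k k _ l])
  finally show ?thesis
    using X B by (simp add: assoc_mult_mat[of _ l k _ k _ l])
qed

lemma spd_add_semidefinite:
  assumes X: "X \<in> carrier_mat k k" "spd X" and Y: "Y \<in> carrier_mat k k" "Y\<^sup>T = Y"
    and nonneg: "\<And>x. x \<in> carrier_vec k \<Longrightarrow> 0 \<le> x \<bullet> (Y *\<^sub>v x)"
  shows "spd (X + Y)"
proof (rule spdI)
  show "X + Y \<in> carrier_mat k k" using X Y by simp
  show "(X + Y)\<^sup>T = X + Y" using X Y by (simp add: transpose_add[of _ k k] spd_def)
  show "0 < x \<bullet> ((X + Y) *\<^sub>v x)" if "x \<in> carrier_vec k" "x \<noteq> 0\<^sub>v k" for x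
    using spdD_pos[OF X(2,1) that] nonneg[OF that(1)] X(1) Y(1) that(1)
    by (simp add: add_mat_quadratic_form[of _ k])
qed

lemma transpose_smult_mat: "(a \<cdot>\<^sub>m X)\<^sup>T = a \<cdot>\<^sub>m X\<^sup>T"
  by (rule eq_matI) auto

section \<open>Inverses of positive definite matrices\<close>

lemma minv_eqI:
  fixes X Y :: "real mat"
  assumes X: "X \<in> carrier_mat k k" and Y: "Y \<in> carrier_mat k k" and XY: "X * Y = 1\<^sub>m k"
  shows "minv X = Y"
proof -
  \<comment> \<open>For square matrices over a field a right inverse is also a left inverse. So
    \<open>X\<close> is a unit, \<open>mat_inverse X\<close> is not \<open>None\<close>, and
    uniqueness of inverses identifies its value with \<open>Y\<close>.\<close>
  have YX: "Y * X = 1\<^sub>m k" by (rule mat_mult_left_right_inverse[OF X Y XY])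
  have "X \<in> Units (ring_mat TYPE(real) k ())"
    using X Y XY YX by (auto simp: Units_def ring_mat_def)
  then obtain Z where Z: "mat_inverse X = Some Z"
    using mat_inverse(1)[OF X, of "()"] by (cases "mat_inverse X") auto
  have Z': "Z * X = 1\<^sub>m k" "Z \<in> carrier_mat k k" using mat_inverse(2)[OF X Z] by auto
  have "Z = Z * (X * Y)" using XY Z' by simp
  also have "\<dots> = Y" using Z' X Y by (simp add: assoc_mult_mat[of _ k k _ k _ k, symmetric])
  finally show ?thesis by (simp add: minv_def Z)
qed

text \<open>A nonzero kernel vector would give the quadratic form the value 0, so definiteness
  forces a nonzero determinant.\<close>

lemma spd_minv:
  assumes X: "X \<in> carrier_mat k k" and "spd X"
  shows minv_carrier: "minv X \<in> carrier_mat k k"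
    and mult_minv: "X * minv X = 1\<^sub>m k"
    and minv_mult: "minv X * X = 1\<^sub>m k"
proof -
  have "det X \<noteq> 0"
  proof
    assume "det X = 0"
    then obtain v where "v \<in> carrier_vec k" "v \<noteq> 0\<^sub>v k" "X *\<^sub>v v = 0\<^sub>v k"
      using det_0_iff_vec_prod_zero_field[OF X] by blast
    then show False using spdD_pos[OF \<open>spd X\<close> X] by fastforce
  qed
  then have "X \<in> Units (ring_mat TYPE(real) k ())"
    by (rule det_non_zero_imp_unit[OF X])
  then obtain Z where Z: "mat_inverse X = Some Z"
    using mat_inverse(1)[OF X, of "()"] by (cases "mat_inverse X") auto
  show "minv X \<in> carrier_mat k k" "X * minv X = 1\<^sub>m k" "minv X * X = 1\<^sub>m k"
    using mat_inverse(2)[OF X Z] by (auto simp: minv_def Z)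
qed

lemma mult_minv_vec:
  assumes "X \<in> carrier_mat k k" "spd X" "x \<in> carrier_vec k"
  shows "X *\<^sub>v (minv X *\<^sub>v x) = x"
  using assms minv_carrier[OF assms(1,2)] mult_minv[OF assms(1,2)]
  by (metis assoc_mult_mat_vec one_mult_mat_vec)

lemma minv_minv:
  assumes "X \<in> carrier_mat k k" "spd X"
  shows "minv (minv X) = X"
  using assms by (intro minv_eqI[of _ k] minv_carrier minv_mult) auto

text \<open>The substitution \<open>x = X *\<^sub>v y\<close> turns the form of the inverse at
  \<open>x\<close> into the form of \<open>X\<close> at \<open>y\<close>. Symmetry follows from
  uniqueness of the inverse, because transposing \<open>minv X * X\<close> makes
  \<open>(minv X)\<^sup>T\<close> a right inverse of \<open>X\<close>.\<close>

lemma spd_minv_spd: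
  assumes X: "X \<in> carrier_mat k k" and "spd X"
  shows "spd (minv X)"
proof (rule spdI)
  note X' = minv_carrier[OF assms]
  show "minv X \<in> carrier_mat k k" by (rule X')
  have "X * (minv X)\<^sup>T = (minv X * X)\<^sup>T"
    using X X' \<open>spd X\<close> by (simp add: transpose_mult[of _ k k _ k] spd_def)
  then have "X * (minv X)\<^sup>T = 1\<^sub>m k"
    by (simp add: minv_mult[OF assms])
  then show "(minv X)\<^sup>T = minv X"
    using X X' by (intro minv_eqI[of _ k, symmetric]) auto
  fix x :: "real vec" assume x: "x \<in> carrier_vec k" "x \<noteq> 0\<^sub>v k"
  define y where "y = minv X *\<^sub>v x"
  have y: "y \<in> carrier_vec k" and Xy: "X *\<^sub>v y = x"
    using X' x mult_minv_vec[OF assms x(1)] by (auto simp: y_def)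
  have "y \<noteq> 0\<^sub>v k" using Xy x X by auto
  then have "0 < y \<bullet> x" using spdD_pos[OF \<open>spd X\<close> X y] Xy by simp
  then show "0 < x \<bullet> (minv X *\<^sub>v x)"
    using comm_scalar_prod[OF x(1) y] by (simp add: y_def)
qed

section \<open>The Loewner order and its reversal under inversion\<close>

lemma loewner_leD:
  assumes "X \<preceq> Y" "X \<in> carrier_mat k k" "x \<in> carrier_vec k"
  shows "x \<bullet> (X *\<^sub>v x) \<le> x \<bullet> (Y *\<^sub>v x)"
  using assms by (auto simp: loewner_le_def)

lemma loewner_le_smult_left:
  assumes "a \<cdot>\<^sub>m X \<preceq> Y" "X \<in> carrier_mat k k" "x \<in> carrier_vec k"
  shows "a * (x \<bullet> (X *\<^sub>v x)) \<le> x \<bullet> (Y *\<^sub>v x)"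
  using loewner_leD[OF assms(1) _ assms(3)] assms(2,3) by (simp add: smult_mat_quadratic_form)

lemma loewner_le_smult_right:
  assumes "X \<preceq> a \<cdot>\<^sub>m Y" "X \<in> carrier_mat k k" "Y \<in> carrier_mat k k" "x \<in> carrier_vec k"
  shows "x \<bullet> (X *\<^sub>v x) \<le> a * (x \<bullet> (Y *\<^sub>v x))"
  using loewner_leD[OF assms(1,2,4)] assms(3,4) by (simp add: smult_mat_quadratic_form)

text \<open>
  With \<open>z = X\<inverse> u\<close> and \<open>y = Y\<inverse> u\<close>, the claim is the nonnegativity of the quadratic form of \<open>X\<close> at
  \<open>z - a y\<close>.
\<close>

lemma minv_quadratic_form_antimono:
  assumes X: "X \<in> carrier_mat k k" "spd X" and Y: "Y \<in> carrier_mat k k" "spd Y"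
    and a: "0 \<le> a"
    and le: "\<And>x. x \<in> carrier_vec k \<Longrightarrow> a * (x \<bullet> (X *\<^sub>v x)) \<le> x \<bullet> (Y *\<^sub>v x)"
    and u: "u \<in> carrier_vec k"
  shows "a * (u \<bullet> (minv Y *\<^sub>v u)) \<le> u \<bullet> (minv X *\<^sub>v u)"
proof -
  define z where "z = minv X *\<^sub>v u"
  define y where "y = minv Y *\<^sub>v u"
  have z: "z \<in> carrier_vec k" and Xz: "X *\<^sub>v z = u"
    using minv_carrier[OF X] mult_minv_vec[OF X u] u by (auto simp: z_def)
  have y: "y \<in> carrier_vec k" and Yy: "Y *\<^sub>v y = u"
    using minv_carrier[OF Y] mult_minv_vec[OF Y u] u by (auto simp: y_def)
  have Xy: "X *\<^sub>v y \<in> carrier_vec k" using X y by auto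
  have zXy: "z \<bullet> (X *\<^sub>v y) = y \<bullet> u"
    using symmetric_scalar_prod_swap[OF X(1) _ z y] X(2) Xz by (simp add: spd_def)
  have "0 \<le> (z - a \<cdot>\<^sub>v y) \<bullet> (X *\<^sub>v (z - a \<cdot>\<^sub>v y))"
    using z y by (intro spdD_nonneg[OF X(2,1)]) auto
  also have "X *\<^sub>v (z - a \<cdot>\<^sub>v y) = u - a \<cdot>\<^sub>v (X *\<^sub>v y)"
    using X z y by (simp add: mult_minus_distrib_mat_vec[of _ k k] mult_mat_vec[of _ k k] Xz)
  also have "(z - a \<cdot>\<^sub>v y) \<bullet> \<dots> = z \<bullet> u - 2 * a * (y \<bullet> u) + a * (a * (y \<bullet> (X *\<^sub>v y)))"
    using z y u Xy
    by (simp add: minus_scalar_prod_distrib[of _ k] scalar_prod_minus_distrib[of _ k]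
        zXy algebra_simps)
  \<comment> \<open>The hypothesis at \<open>y\<close> bounds
    \<open>a * (y \<bullet> (X *\<^sub>v y))\<close> by \<open>y \<bullet> u\<close>, which absorbs
    one of the two copies of \<open>a * (y \<bullet> u)\<close>.\<close>
  also have "\<dots> \<le> z \<bullet> u - 2 * a * (y \<bullet> u) + a * (y \<bullet> u)"
    using mult_left_mono[OF le[OF y] a] by (simp add: Yy)
  finally have "a * (y \<bullet> u) \<le> z \<bullet> u" by simp
  then show ?thesis
    using comm_scalar_prod[OF u z] comm_scalar_prod[OF u y] by (simp add: z_def y_def)
qed

text \<open>Dividing the hypothesis by \<open>a\<close> reduces this to the previous lemma with
  factor \<open>inverse a\<close>.\<close>

lemma minv_quadratic_form_antimono_right:
  assumes X: "X \<in> carrier_mat k k" "spd X" and Y: "Y \<in> carrier_mat k k" "spd Y"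
    and a: "0 < a"
    and le: "\<And>x. x \<in> carrier_vec k \<Longrightarrow> x \<bullet> (X *\<^sub>v x) \<le> a * (x \<bullet> (Y *\<^sub>v x))"
    and u: "u \<in> carrier_vec k"
  shows "u \<bullet> (minv Y *\<^sub>v u) \<le> a * (u \<bullet> (minv X *\<^sub>v u))"
proof -
  have "inverse a * (u \<bullet> (minv Y *\<^sub>v u)) \<le> u \<bullet> (minv X *\<^sub>v u)"
    using a le by (intro minv_quadratic_form_antimono[OF X Y _ _ u]) (auto simp: field_simps)
  then show ?thesis using a by (simp add: field_simps)
qed

section \<open>The spectrum of a symmetric definite pencil\<close>

text \<open>
  With \<open>Q x = Re v\<close> and \<open>Q y = Im v\<close> for an eigenvector \<open>v\<close>, the symmetry of \<open>P\<close> forces the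
  eigenvalue to be real, and it is then a Rayleigh quotient of the pencil.
\<close>

lemma cspectrum_mult_minv_bounds:
  assumes P: "P \<in> carrier_mat k k" "spd P" and Q: "Q \<in> carrier_mat k k" "spd Q"
    and lower: "\<And>x. x \<in> carrier_vec k \<Longrightarrow> f * (x \<bullet> (Q *\<^sub>v x)) \<le> x \<bullet> (P *\<^sub>v x)"
    and upper: "\<And>x. x \<in> carrier_vec k \<Longrightarrow> x \<bullet> (P *\<^sub>v x) \<le> F * (x \<bullet> (Q *\<^sub>v x))"
  shows "cspectrum (P * minv Q) \<subseteq> complex_of_real ` {f..F}"
proof
  fix l assume "l \<in> cspectrum (P * minv Q)"
  define M where "M = P * minv Q"
  note Q' = minv_carrier[OF Q]
  have M: "M \<in> carrier_mat k k" using P Q' by (simp add: M_def)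
  from \<open>l \<in> _\<close> obtain v where v: "v \<in> carrier_vec k" "v \<noteq> 0\<^sub>v k"
    and ev: "map_mat complex_of_real M *\<^sub>v v = l \<cdot>\<^sub>v v"
    using M by (auto simp: cspectrum_def spectrum_def eigenvalue_def eigenvector_def M_def)
  define p q where "p = Re l" and "q = Im l"
  define a b where "a = map_vec Re v" and "b = map_vec Im v"
  have a: "a \<in> carrier_vec k" and b: "b \<in> carrier_vec k" using v by (auto simp: a_def b_def)
  have ab: "a \<noteq> 0\<^sub>v k \<or> b \<noteq> 0\<^sub>v k"
  proof (rule ccontr)
    assume "\<not> ?thesis"
    then have "\<forall>i<k. Re (v $ i) = 0 \<and> Im (v $ i) = 0"
      using v by (metis a_def b_def carrier_vecD index_map_vec(1) index_zero_vec(1))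
    then have "v = 0\<^sub>v k" using v by (intro eq_vecI) (auto simp: complex_eq_iff)
    then show False using v by simp
  qed
  \<comment> \<open>Since \<open>M\<close> is real, the real and imaginary parts of this complex
    equation give the two coupled real systems \<open>Ma\<close> and \<open>Mb\<close>.\<close>
  have entry: "(\<Sum>j = 0..<k. complex_of_real (M $$ (i, j)) * v $ j) = l * v $ i" if "i < k" for i
    using arg_cong[OF ev, of "\<lambda>w. w $ i"] that M v by (simp add: scalar_prod_def)
  have Ma: "M *\<^sub>v a = p \<cdot>\<^sub>v a - q \<cdot>\<^sub>v b"
  proof (rule eq_vecI)
    fix i assume "i < dim_vec (p \<cdot>\<^sub>v a - q \<cdot>\<^sub>v b)"
    then have i: "i < k" using b by simp
    show "(M *\<^sub>v a) $ i = (p \<cdot>\<^sub>v a - q \<cdot>\<^sub>v b) $ i"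
      using arg_cong[OF entry[OF i], of Re] i M v
      by (simp add: scalar_prod_def a_def b_def p_def q_def)
  qed (use M b in auto)
  have Mb: "M *\<^sub>v b = p \<cdot>\<^sub>v b + q \<cdot>\<^sub>v a"
  proof (rule eq_vecI)
    fix i assume "i < dim_vec (p \<cdot>\<^sub>v b + q \<cdot>\<^sub>v a)"
    then have i: "i < k" using a by simp
    show "(M *\<^sub>v b) $ i = (p \<cdot>\<^sub>v b + q \<cdot>\<^sub>v a) $ i"
      using arg_cong[OF entry[OF i], of Im] i M v
      by (simp add: scalar_prod_def a_def b_def p_def q_def)
  qed (use M a in auto)
  \<comment> \<open>Pulling \<open>a\<close> and \<open>b\<close> back through \<open>Q\<close>
    turns the eigenvalue equation of \<open>P * minv Q\<close> into that of the pencil,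
    \<open>P\<close> applied to x + iy being l times \<open>Q\<close> applied to x + iy.\<close>
  define x y where "x = minv Q *\<^sub>v a" and "y = minv Q *\<^sub>v b"
  have x: "x \<in> carrier_vec k" and y: "y \<in> carrier_vec k" using Q' a b by (auto simp: x_def y_def)
  have Qx: "Q *\<^sub>v x = a" and Qy: "Q *\<^sub>v y = b"
    using mult_minv_vec[OF Q] a b by (auto simp: x_def y_def)
  have Px: "P *\<^sub>v x = p \<cdot>\<^sub>v a - q \<cdot>\<^sub>v b" and Py: "P *\<^sub>v y = p \<cdot>\<^sub>v b + q \<cdot>\<^sub>v a"
    using P Q' a b Ma Mb by (auto simp: x_def y_def M_def)
  have nonneg: "0 \<le> x \<bullet> a" "0 \<le> y \<bullet> b"
    using spdD_nonneg[OF Q(2,1) x] spdD_nonneg[OF Q(2,1) y] by (simp_all add: Qx Qy)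
  have "x \<noteq> 0\<^sub>v k \<or> y \<noteq> 0\<^sub>v k" using ab Qx Qy Q(1) by auto
  then have pos: "0 < x \<bullet> a + y \<bullet> b"
    using spdD_pos[OF Q(2,1) x] spdD_pos[OF Q(2,1) y] nonneg by (auto simp: Qx Qy)
  have xb: "x \<bullet> b = y \<bullet> a"
    using symmetric_scalar_prod_swap[OF Q(1) _ x y] Q(2) by (simp add: spd_def Qx Qy)
  \<comment> \<open>Expanding both sides with \<open>Px\<close> and \<open>Py\<close>, the terms
    with \<open>p\<close> cancel by \<open>xb\<close>, and only \<open>q\<close> times a positive
    number remains.\<close>
  have "x \<bullet> (P *\<^sub>v y) = y \<bullet> (P *\<^sub>v x)"
    using symmetric_scalar_prod_swap[OF P(1) _ x y] P(2) by (simp add: spd_def)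
  then have "q * (x \<bullet> a + y \<bullet> b) = 0"
    using x y a b
    by (simp add: Px Py scalar_prod_add_distrib[of _ k] scalar_prod_minus_distrib[of _ k] xb
        algebra_simps)
  then have q: "q = 0" using pos by simp
  have xPx: "x \<bullet> (P *\<^sub>v x) = p * (x \<bullet> a)" and yPy: "y \<bullet> (P *\<^sub>v y) = p * (y \<bullet> b)"
    using x y a b
    by (simp_all add: Px Py q scalar_prod_add_distrib[of _ k] scalar_prod_minus_distrib[of _ k])
  \<comment> \<open>One of \<open>x\<close> and \<open>y\<close> may vanish, so the bounds are added
    before dividing: only the sum of the two forms is known to be positive.\<close>
  have "f * (x \<bullet> a + y \<bullet> b) \<le> p * (x \<bullet> a + y \<bullet> b)"
    using lower[OF x] lower[OF y] by (simp add: xPx yPy Qx Qy distrib_left)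
  moreover have "p * (x \<bullet> a + y \<bullet> b) \<le> F * (x \<bullet> a + y \<bullet> b)"
    using upper[OF x] upper[OF y] by (simp add: xPx yPy Qx Qy distrib_left)
  ultimately have "p \<in> {f..F}" using pos by (simp add: mult_le_cancel_right)
  moreover have "l = complex_of_real p" using q by (simp add: complex_eq_iff p_def q_def)
  ultimately show "l \<in> complex_of_real ` {f..F}" by blast
qed

section \<open>Schur complements\<close>

lemma schur_carrier:
  assumes "A \<in> carrier_mat n n" "spd A" "B \<in> carrier_mat m n"
  shows "schur A B \<in> carrier_mat m m"
  using assms minv_carrier[OF assms(1,2)] by (simp add: schur_def)

lemma schur_symmetric:
  assumes "A \<in> carrier_mat n n" "spd A" "B \<in> carrier_mat m n"
  shows "(schur A B)\<^sup>T = schur A B"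
  using congruence_symmetric[of "minv A" n "B\<^sup>T" m] assms minv_carrier[OF assms(1,2)]
    spd_minv_spd[OF assms(1,2)]
  by (simp add: schur_def spd_def)

lemma augmented_carrier:
  assumes "A \<in> carrier_mat n n" "B \<in> carrier_mat m n" "W \<in> carrier_mat m m" "spd W"
  shows "augmented \<gamma> A B W \<in> carrier_mat n n"
  using assms minv_carrier[OF assms(3,4)] by (simp add: augmented_def)

text \<open>The augmentation term is only semidefinite, since it vanishes on the kernel of
  \<open>B\<close>; definiteness comes from \<open>A\<close>.\<close>

lemma augmented_spd:
  assumes A: "A \<in> carrier_mat n n" "spd A" and B: "B \<in> carrier_mat m n"
    and W: "W \<in> carrier_mat m m" "spd W" and \<gamma>: "0 \<le> \<gamma>"
  shows "spd (augmented \<gamma> A B W)"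
  unfolding augmented_def
proof (rule spd_add_semidefinite[OF A])
  note W' = minv_carrier[OF W] spd_minv_spd[OF W]
  show "\<gamma> \<cdot>\<^sub>m (B\<^sup>T * minv W * B) \<in> carrier_mat n n" using B W' by simp
  show "(\<gamma> \<cdot>\<^sub>m (B\<^sup>T * minv W * B))\<^sup>T = \<gamma> \<cdot>\<^sub>m (B\<^sup>T * minv W * B)"
    using congruence_symmetric[of "minv W" m B n] B W' by (simp add: transpose_smult_mat spd_def)
  fix x :: "real vec" assume x: "x \<in> carrier_vec n"
  have "0 \<le> (B *\<^sub>v x) \<bullet> (minv W *\<^sub>v (B *\<^sub>v x))"
    using B x by (intro spdD_nonneg[OF W'(2,1)]) auto
  then have "0 \<le> \<gamma> * (x \<bullet> ((B\<^sup>T * minv W * B) *\<^sub>v x))"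
    unfolding congruence_quadratic_form[OF W'(1) B x] using \<gamma> by simp
  moreover have "B\<^sup>T * minv W * B \<in> carrier_mat n n" using B W' by simp
  ultimately show "0 \<le> x \<bullet> ((\<gamma> \<cdot>\<^sub>m (B\<^sup>T * minv W * B)) *\<^sub>v x)"
    using x by (simp only: smult_mat_quadratic_form)
qed

text \<open>
  The identity behind this is \<open>(A + \<gamma> B\<^sup>T W\<inverse> B) A\<inverse> B\<^sup>T = B\<^sup>T (S\<inverse> + \<gamma> W\<inverse>) S\<close>.
\<close>

lemma schur_augmented:
  assumes A: "A \<in> carrier_mat n n" "spd A" and B: "B \<in> carrier_mat m n"
    and W: "W \<in> carrier_mat m m" "spd W" and \<gamma>: "0 \<le> \<gamma>"
    and S: "spd (schur A B)"
  shows "schur (augmented \<gamma> A B W) B = minv (minv (schur A B) + \<gamma> \<cdot>\<^sub>m minv W)"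
proof -
  define T where "T = schur A B"
  define G where "G = augmented \<gamma> A B W"
  define Q where "Q = minv T + \<gamma> \<cdot>\<^sub>m minv W"
  have T: "T \<in> carrier_mat m m" "spd T" using schur_carrier[OF A B] S by (auto simp: T_def)
  have G: "G \<in> carrier_mat n n" "spd G"
    using augmented_carrier[OF A(1) B W] augmented_spd[OF A B W \<gamma>] by (auto simp: G_def)
  note A' = minv_carrier[OF A] and W' = minv_carrier[OF W] and T' = minv_carrier[OF T]
    and G' = minv_carrier[OF G]
  have Q: "Q \<in> carrier_mat m m" using T' W' by (simp add: Q_def)
  have Bt: "B\<^sup>T \<in> carrier_mat n m" using B by simp
  have AB: "minv A * B\<^sup>T \<in> carrier_mat n m" using A' Bt by simp
  have BAB: "B * (minv A * B\<^sup>T) = T"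
    using B A' Bt by (simp add: T_def schur_def assoc_mult_mat[of _ m n _ n _ m])
  have QT: "Q * T = 1\<^sub>m m + \<gamma> \<cdot>\<^sub>m (minv W * T)"
    using T T' W' by (simp add: Q_def add_mult_distrib_mat[of _ m m _ _ m] minv_mult
        mult_smult_assoc_mat[of _ m m _ m])
  have "G * (minv A * B\<^sup>T) =
      A * (minv A * B\<^sup>T) + \<gamma> \<cdot>\<^sub>m ((B\<^sup>T * minv W * B) * (minv A * B\<^sup>T))"
    unfolding G_def augmented_def
    using A A' B Bt W' AB
    by (subst add_mult_distrib_mat[of _ n n _ _ m]) auto
  also have "A * (minv A * B\<^sup>T) = B\<^sup>T"
    using assoc_mult_mat[OF A(1) A' Bt] Bt by (simp add: mult_minv[OF A])
  also have "(B\<^sup>T * minv W * B) * (minv A * B\<^sup>T) = B\<^sup>T * minv W * T"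
    unfolding BAB[symmetric] using B Bt W' AB by (intro assoc_mult_mat[of _ n m _ n _ m]) auto
  also have "B\<^sup>T * minv W * T = B\<^sup>T * (minv W * T)"
    using Bt W' T by (simp add: assoc_mult_mat[of _ n m _ m _ m])
  also have "B\<^sup>T + \<gamma> \<cdot>\<^sub>m (B\<^sup>T * (minv W * T)) = B\<^sup>T * (Q * T)"
    using Bt W' T
    by (simp add: QT mult_add_distrib_mat[of _ n m _ m] mult_smult_distrib[of _ n m _ m])
  \<comment> \<open>Cancelling \<open>G\<close> and then multiplying by \<open>B\<close> from the
    left produces \<open>T\<close> on the left by \<open>BAB\<close>, and the Schur complement of
    \<open>G\<close> on the right.\<close>
  finally have "minv G * (G * (minv A * B\<^sup>T)) = minv G * (B\<^sup>T * (Q * T))" by simp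
  then have "minv A * B\<^sup>T = minv G * (B\<^sup>T * (Q * T))"
    using assoc_mult_mat[OF G' G(1) AB] left_mult_one_mat[OF AB] minv_mult[OF G] by metis
  then have "T = B * (minv G * (B\<^sup>T * (Q * T)))" using BAB by simp
  also have "\<dots> = schur G B * Q * T"
  proof -
    have "B * (minv G * (B\<^sup>T * (Q * T))) = B * minv G * (B\<^sup>T * (Q * T))"
      using B G' Bt Q T by (intro assoc_mult_mat[of _ m n _ n _ m, symmetric]) auto
    also have "\<dots> = schur G B * (Q * T)"
      unfolding schur_def
      using B G' Bt Q T by (intro assoc_mult_mat[of _ m n _ m _ m, symmetric]) auto
    also have "\<dots> = schur G B * Q * T"
      using schur_carrier[OF G B] Q T by (intro assoc_mult_mat[of _ m m _ m _ m, symmetric]) auto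
    finally show ?thesis .
  qed
  \<comment> \<open>Cancelling \<open>T\<close> on the right exhibits \<open>schur G B\<close> as a
    left inverse of \<open>Q\<close>; both are square, so it is also a right inverse.\<close>
  finally have "T * minv T = (schur G B * Q * T) * minv T" by simp
  also have "\<dots> = schur G B * Q"
    using assoc_mult_mat[OF mult_carrier_mat[OF schur_carrier[OF G B] Q] T(1) T']
      right_mult_one_mat[OF mult_carrier_mat[OF schur_carrier[OF G B] Q]] mult_minv[OF T]
    by metis
  finally have "schur G B * Q = 1\<^sub>m m" using T by (simp add: mult_minv)
  then have "Q * schur G B = 1\<^sub>m m"
    using mat_mult_left_right_inverse schur_carrier[OF G B] Q by blast
  then have "minv Q = schur G B"
    using schur_carrier[OF G B] Q by (intro minv_eqI)
  then show ?thesis by (simp add: G_def Q_def T_def)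
qed

section \<open>Scalar estimates\<close>

lemma f_low_le:
  fixes s t w c d e E \<gamma> :: real
  assumes pos: "0 < c" "0 < d" "0 < e" "0 < E" "0 < \<gamma>" and s: "0 < s" and t: "0 < t"
    and st: "c * s \<le> t" and sw: "d * s \<le> w" and tw: "e * t \<le> w" "w \<le> E * t"
  shows "f_low c d e E \<gamma> * (s + \<gamma> * w) \<le> t + \<gamma> * w"
proof -
  have w: "0 < w" using pos tw t by (meson mult_pos_pos less_le_trans)
  have p: "0 < s + \<gamma> * w" using s w pos by (simp add: add_pos_pos)
  \<comment> \<open>Both summands of the denominator are compared with \<open>t\<close>: s \<le> t /
    c and w \<le> E t.\<close>
  have "c / (1 + \<gamma> * c * E) \<le> t / (s + \<gamma> * w)"
  proof -
    have "\<gamma> * c * w \<le> \<gamma> * c * (E * t)"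
      using tw(2) pos by (intro mult_left_mono) auto
    with st have "c * (s + \<gamma> * w) \<le> t * (1 + \<gamma> * c * E)" by (simp add: algebra_simps)
    moreover have "0 < 1 + \<gamma> * c * E" using pos by (simp add: add_pos_pos)
    ultimately show ?thesis using p by (simp add: divide_le_eq le_divide_eq)
  qed
  \<comment> \<open>This quotient increases with w / s, which is at least \<open>d\<close>.\<close>
  moreover have "\<gamma> * d / (1 + \<gamma> * d) \<le> \<gamma> * w / (s + \<gamma> * w)"
  proof -
    have "(\<gamma> * d) * (s + \<gamma> * w) \<le> (\<gamma> * w) * (1 + \<gamma> * d)"
      using mult_left_mono[OF sw, of \<gamma>] pos by (simp add: algebra_simps)
    moreover have "0 < 1 + \<gamma> * d" using pos by (simp add: add_pos_pos)
    ultimately show ?thesis using p by (simp add: divide_le_eq le_divide_eq)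
  qed
  ultimately have "c / (1 + \<gamma> * c * E) + \<gamma> * d / (1 + \<gamma> * d) \<le> (t + \<gamma> * w) / (s + \<gamma> * w)"
    by (simp add: add_divide_distrib)
  moreover have "(1 + \<gamma> * e) / (max 1 (inverse c) + \<gamma> * e) \<le> (t + \<gamma> * w) / (s + \<gamma> * w)"
  proof -
    \<comment> \<open>\<open>K\<close> satisfies s \<le> K t. Having also 1 \<le> K makes (1 +
      \<gamma> r) / (K + \<gamma> r) nondecreasing in r = w / t, so r may be replaced by its lower
      bound \<open>e\<close>.\<close>
    define K where "K = max 1 (inverse c)"
    have K: "1 \<le> K" by (simp add: K_def)
    have "s \<le> inverse c * t" using st pos by (simp add: field_simps)
    also have "\<dots> \<le> K * t" using t by (intro mult_right_mono) (auto simp: K_def)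
    finally have "(1 + \<gamma> * e) * (s + \<gamma> * w) \<le> (1 + \<gamma> * e) * (K * t + \<gamma> * w)"
      using pos by (intro mult_left_mono) (auto simp: add_pos_pos)
    also have "\<dots> = (t + \<gamma> * w) * (K + \<gamma> * e) - \<gamma> * (K - 1) * (w - e * t)"
      by (simp add: algebra_simps)
    also have "\<dots> \<le> (t + \<gamma> * w) * (K + \<gamma> * e)"
      using K pos tw by simp
    finally have "(1 + \<gamma> * e) * (s + \<gamma> * w) \<le> (t + \<gamma> * w) * (K + \<gamma> * e)" .
    moreover have "0 < K + \<gamma> * e" using K pos by (simp add: add_pos_pos)
    ultimately show ?thesis using p by (simp add: divide_le_eq le_divide_eq K_def[symmetric])
  qed
  ultimately have "f_low c d e E \<gamma> \<le> (t + \<gamma> * w) / (s + \<gamma> * w)"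
    by (simp add: f_low_def)
  then show ?thesis using p by (simp add: le_divide_eq)
qed

lemma le_F_up:
  fixes s t w C D e \<gamma> :: real
  assumes pos: "0 < C" "0 < D" "0 < e" "0 < \<gamma>" and s: "0 < s" and t: "0 < t"
    and st: "t \<le> C * s" and sw: "w \<le> D * s" and tw: "e * t \<le> w"
  shows "t + \<gamma> * w \<le> F_up C D e \<gamma> * (s + \<gamma> * w)"
proof -
  have w: "0 < w" using pos tw t by (meson mult_pos_pos less_le_trans)
  have p: "0 < s + \<gamma> * w" using s w pos by (simp add: add_pos_pos)
  \<comment> \<open>Here the denominator is bounded from below, by s \<ge> t / C and w \<ge> e
    t.\<close>
  have "t / (s + \<gamma> * w) \<le> C / (1 + \<gamma> * C * e)"
  proof -
    have "\<gamma> * C * (e * t) \<le> \<gamma> * C * w"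
      using tw pos by (intro mult_left_mono) auto
    with st have "t * (1 + \<gamma> * C * e) \<le> C * (s + \<gamma> * w)" by (simp add: algebra_simps)
    moreover have "0 < 1 + \<gamma> * C * e" using pos by (simp add: add_pos_pos)
    ultimately show ?thesis using p by (simp add: divide_le_eq le_divide_eq)
  qed
  moreover have "\<gamma> * w / (s + \<gamma> * w) \<le> \<gamma> * D / (1 + \<gamma> * D)"
  proof -
    have "(\<gamma> * w) * (1 + \<gamma> * D) \<le> (\<gamma> * D) * (s + \<gamma> * w)"
      using mult_left_mono[OF sw, of \<gamma>] pos by (simp add: algebra_simps)
    moreover have "0 < 1 + \<gamma> * D" using pos by (simp add: add_pos_pos)
    ultimately show ?thesis using p by (simp add: divide_le_eq le_divide_eq)
  qed
  ultimately have "(t + \<gamma> * w) / (s + \<gamma> * w) \<le> C / (1 + \<gamma> * C * e) + \<gamma> * D / (1 + \<gamma> * D)"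
    by (simp add: add_divide_distrib)
  moreover have "(t + \<gamma> * w) / (s + \<gamma> * w) \<le> (1 + \<gamma> * e) / (min 1 (inverse C) + \<gamma> * e)"
  proof -
    \<comment> \<open>Now K t \<le> s, and K \<le> 1 makes (1 + \<gamma> r) / (K + \<gamma> r)
      nonincreasing in r = w / t. The lower bound \<open>e\<close> of r therefore yields an upper
      bound, which is why \<open>e\<close> occurs here as well as in \<open>f_low\<close>.\<close>
    define K where "K = min 1 (inverse C)"
    have K: "0 < K" "K \<le> 1" using pos by (auto simp: K_def)
    have "(t + \<gamma> * w) * (K + \<gamma> * e) \<le> (t + \<gamma> * w) * (K + \<gamma> * e) + \<gamma> * (1 - K) * (w - e * t)"
      using K pos tw by simp
    also have "\<dots> = (1 + \<gamma> * e) * (K * t + \<gamma> * w)"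
      by (simp add: algebra_simps)
    also have "\<dots> \<le> (1 + \<gamma> * e) * (s + \<gamma> * w)"
    proof -
      have "K * t \<le> inverse C * t" using t by (intro mult_right_mono) (auto simp: K_def)
      also have "\<dots> \<le> s" using st pos by (simp add: field_simps)
      finally show ?thesis using pos by (intro mult_left_mono) (auto simp: add_pos_pos)
    qed
    finally have "(t + \<gamma> * w) * (K + \<gamma> * e) \<le> (1 + \<gamma> * e) * (s + \<gamma> * w)" .
    moreover have "0 < K + \<gamma> * e" using K pos by (simp add: add_pos_pos)
    ultimately show ?thesis using p by (simp add: divide_le_eq le_divide_eq K_def[symmetric])
  qed
  ultimately have "(t + \<gamma> * w) / (s + \<gamma> * w) \<le> F_up C D e \<gamma>"
    by (simp add: F_up_def)
  then show ?thesis using p by (simp add: divide_le_eq)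
qed

section \<open>Positivity and limits of the spectral bounds\<close>

lemma f_low_pos:
  assumes "0 < c" "0 < d" "0 < E" "0 < \<gamma>"
  shows "0 < f_low c d e E \<gamma>"
proof -
  have "0 < c / (1 + \<gamma> * c * E) + \<gamma> * d / (1 + \<gamma> * d)"
    using assms by (intro add_pos_pos divide_pos_pos mult_pos_pos) auto
  then show ?thesis by (simp add: f_low_def less_max_iff_disj)
qed

text \<open>\<open>F_up\<close> serves as a constant of spectral equivalence, hence must be
  positive. A minimum needs both arguments positive, whereas one sufficed for the maximum in
  \<open>f_low\<close>.\<close>

lemma F_up_pos:
  assumes "0 < C" "0 < D" "0 < e" "0 < \<gamma>"
  shows "0 < F_up C D e \<gamma>"
proof -
  have "0 < C / (1 + \<gamma> * C * e) + \<gamma> * D / (1 + \<gamma> * D)"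
    using assms by (intro add_pos_pos divide_pos_pos mult_pos_pos) auto
  moreover have "0 < (1 + \<gamma> * e) / (min 1 (inverse C) + \<gamma> * e)"
    using assms by (intro add_pos_pos divide_pos_pos mult_pos_pos) auto
  ultimately show ?thesis by (simp add: F_up_def)
qed

lemma tendsto_f_low:
  assumes "0 < c" "0 < d" "0 < e" "0 < E"
  shows "((\<lambda>g. f_low c d e E g) \<longlongrightarrow> 1) at_top"
proof -
  have "((\<lambda>g. c / (1 + g * c * E) + g * d / (1 + g * d)) \<longlongrightarrow> 1) at_top"
    using assms by real_asymp
  \<comment> \<open>An arbitrary constant \<open>K\<close> stands for
    \<open>max 1 (inverse c)\<close>, as its value does not affect the limit.\<close>
  moreover have "((\<lambda>g. (1 + g * e) / (K + g * e)) \<longlongrightarrow> 1) at_top" for K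
    using assms by real_asymp
  ultimately have "((\<lambda>g. f_low c d e E g) \<longlongrightarrow> max 1 1) at_top"
    unfolding f_low_def by (rule tendsto_max)
  then show ?thesis by simp
qed

lemma tendsto_F_up:
  assumes "0 < C" "0 < D" "0 < e"
  shows "((\<lambda>g. F_up C D e g) \<longlongrightarrow> 1) at_top"
proof -
  have "((\<lambda>g. C / (1 + g * C * e) + g * D / (1 + g * D)) \<longlongrightarrow> 1) at_top"
    using assms by real_asymp
  moreover have "((\<lambda>g. (1 + g * e) / (K + g * e)) \<longlongrightarrow> 1) at_top" for K
    using assms by real_asymp
  ultimately have "((\<lambda>g. F_up C D e g) \<longlongrightarrow> min 1 1) at_top"
    unfolding F_up_def by (rule tendsto_min)
  then show ?thesis by simp
qed

section \<open>The preconditioned augmented Schur complement\<close>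

lemma inverse_sum_quadratic_form_bounds:
  assumes S: "S \<in> carrier_mat m m" "spd S" and Shat: "Shat \<in> carrier_mat m m" "spd Shat"
    and W: "W \<in> carrier_mat m m" "spd W"
    and pos: "0 < c" "0 < C" "0 < d" "0 < D" "0 < e" "0 < E" "0 < \<gamma>"
    and Shat_S: "c \<cdot>\<^sub>m Shat \<preceq> S" "S \<preceq> C \<cdot>\<^sub>m Shat"
    and W_S: "d \<cdot>\<^sub>m W \<preceq> S" "S \<preceq> D \<cdot>\<^sub>m W"
    and W_Shat: "e \<cdot>\<^sub>m W \<preceq> Shat" "Shat \<preceq> E \<cdot>\<^sub>m W"
    and x: "x \<in> carrier_vec m"
  shows "f_low c d e E \<gamma> * (x \<bullet> ((minv S + \<gamma> \<cdot>\<^sub>m minv W) *\<^sub>v x))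
           \<le> x \<bullet> ((minv Shat + \<gamma> \<cdot>\<^sub>m minv W) *\<^sub>v x)" (is ?lower)
    and "x \<bullet> ((minv Shat + \<gamma> \<cdot>\<^sub>m minv W) *\<^sub>v x)
           \<le> F_up C D e \<gamma> * (x \<bullet> ((minv S + \<gamma> \<cdot>\<^sub>m minv W) *\<^sub>v x))" (is ?upper)
proof -
  note S' = minv_carrier[OF S] spd_minv_spd[OF S]
    and Shat' = minv_carrier[OF Shat] spd_minv_spd[OF Shat]
    and W' = minv_carrier[OF W] spd_minv_spd[OF W]
  define s where "s = x \<bullet> (minv S *\<^sub>v x)"
  define t where "t = x \<bullet> (minv Shat *\<^sub>v x)"
  define w where "w = x \<bullet> (minv W *\<^sub>v x)"
  have Q: "x \<bullet> ((minv S + \<gamma> \<cdot>\<^sub>m minv W) *\<^sub>v x) = s + \<gamma> * w"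
    and P: "x \<bullet> ((minv Shat + \<gamma> \<cdot>\<^sub>m minv W) *\<^sub>v x) = t + \<gamma> * w"
    using S' Shat' W' x
    by (simp_all add: add_mat_quadratic_form[of _ m] smult_mat_quadratic_form[of _ m]
        s_def t_def w_def)
  \<comment> \<open>Each Loewner bound keeps its constant while the two matrices trade places under
    inversion: c Shat \<le> S becomes c s \<le> t.\<close>
  have bounds: "c * s \<le> t" "t \<le> C * s" "d * s \<le> w" "w \<le> D * s" "e * t \<le> w" "w \<le> E * t"
    unfolding s_def t_def w_def
    using pos S Shat W
    by (auto intro!: minv_quadratic_form_antimono[of _ m] minv_quadratic_form_antimono_right[of _ m]
        x loewner_le_smult_left[OF Shat_S(1)] loewner_le_smult_right[OF Shat_S(2)]
        loewner_le_smult_left[OF W_S(1)] loewner_le_smult_right[OF W_S(2)]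
        loewner_le_smult_left[OF W_Shat(1)] loewner_le_smult_right[OF W_Shat(2)])
  have "?lower \<and> ?upper"
  proof (cases "x = 0\<^sub>v m")
    \<comment> \<open>At the zero vector the scalar estimates do not apply, since they require
      positive \<open>s\<close> and \<open>t\<close>, but all the forms vanish.\<close>
    case True
    then have "s = 0" "t = 0" "w = 0" using S' Shat' W' by (auto simp: s_def t_def w_def)
    then show ?thesis by (simp add: P Q)
  next
    case False
    then have "0 < s" "0 < t"
      using spdD_pos[OF S'(2,1) x] spdD_pos[OF Shat'(2,1) x] by (auto simp: s_def t_def)
    then show ?thesis
      using f_low_le[of c d e E \<gamma> s t w] le_F_up[of C D e \<gamma> s t w] bounds pos by (simp add: P Q)
  qed
  then show ?lower ?upper by auto
qed

lemma spd_inverse_sum: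
  assumes X: "X \<in> carrier_mat k k" "spd X" and W: "W \<in> carrier_mat k k" "spd W" and \<gamma>: "0 \<le> \<gamma>"
  shows "spd (minv X + \<gamma> \<cdot>\<^sub>m minv W)"
proof -
  note W' = minv_carrier[OF W] spd_minv_spd[OF W]
  have "0 \<le> x \<bullet> ((\<gamma> \<cdot>\<^sub>m minv W) *\<^sub>v x)" if "x \<in> carrier_vec k" for x
    using that W' \<gamma> spdD_nonneg[OF W'(2,1) that] by (simp add: smult_mat_quadratic_form[of _ k])
  then show ?thesis
    using W' minv_carrier[OF X] spd_minv_spd[OF X]
    by (intro spd_add_semidefinite[of _ k]) (auto simp: transpose_smult_mat spd_def)
qed

theorem lemma3p1:
  fixes n m :: "'h \<Rightarrow> nat"
    and A B Shat W :: "'h \<Rightarrow> real mat"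
    and \<gamma> c C d D e E :: real
  assumes A: "\<And>h. A h \<in> carrier_mat (n h) (n h)" "\<And>h. spd (A h)"
    and B: "\<And>h. B h \<in> carrier_mat (m h) (n h)" "\<And>h. vec_space.rank (m h) (B h) = m h"
    and Shat: "\<And>h. Shat h \<in> carrier_mat (m h) (m h)" "\<And>h. spd (Shat h)"
    and W: "\<And>h. W h \<in> carrier_mat (m h) (m h)" "\<And>h. spd (W h)"
    and \<gamma>: "\<gamma> > 0"
    and pos: "c > 0" "C > 0" "d > 0" "D > 0" "e > 0" "E > 0"
    and Shat_S: "\<And>h. c \<cdot>\<^sub>m Shat h \<preceq> schur (A h) (B h)" "\<And>h. schur (A h) (B h) \<preceq> C \<cdot>\<^sub>m Shat h"
    and W_S: "\<And>h. d \<cdot>\<^sub>m W h \<preceq> schur (A h) (B h)" "\<And>h. schur (A h) (B h) \<preceq> D \<cdot>\<^sub>m W h"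
    and W_Shat: "\<And>h. e \<cdot>\<^sub>m W h \<preceq> Shat h" "\<And>h. Shat h \<preceq> E \<cdot>\<^sub>m W h"
  shows "spectrally_equivalent
           (\<lambda>h. schur_precond \<gamma> (Shat h) (W h))
           (\<lambda>h. schur (augmented \<gamma> (A h) (B h) (W h)) (B h))
       \<and> (\<forall>h. cspectrum (minv (schur_precond \<gamma> (Shat h) (W h)) *
                          schur (augmented \<gamma> (A h) (B h) (W h)) (B h))
              \<subseteq> complex_of_real ` {f_low c d e E \<gamma> .. F_up C D e \<gamma>})
       \<and> ((\<lambda>g. f_low c d e E g) \<longlongrightarrow> 1) at_top
       \<and> ((\<lambda>g. F_up C D e g) \<longlongrightarrow> 1) at_top"
proof -
  define P where "P h = minv (Shat h) + \<gamma> \<cdot>\<^sub>m minv (W h)" for h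
  define Q where "Q h = minv (schur (A h) (B h)) + \<gamma> \<cdot>\<^sub>m minv (W h)" for h
  let ?f = "f_low c d e E \<gamma>" and ?F = "F_up C D e \<gamma>"
  have S: "schur (A h) (B h) \<in> carrier_mat (m h) (m h)" for h
    by (rule schur_carrier[OF A B(1)])
  \<comment> \<open>Definiteness is inherited from \<open>Shat h\<close> through the lower bound
    with \<open>c\<close>.\<close>
  have S_spd: "spd (schur (A h) (B h))" for h
  proof (rule spdI[OF S schur_symmetric[OF A B(1)]])
    fix x :: "real vec" assume x: "x \<in> carrier_vec (m h)" "x \<noteq> 0\<^sub>v (m h)"
    have "0 < c * (x \<bullet> (Shat h *\<^sub>v x))"
      using spdD_pos[OF Shat(2,1) x] pos by simp
    also have "\<dots> \<le> x \<bullet> (schur (A h) (B h) *\<^sub>v x)"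
      by (rule loewner_le_smult_left[OF Shat_S(1) Shat(1) x(1)])
    finally show "0 < x \<bullet> (schur (A h) (B h) *\<^sub>v x)" .
  qed
  have P: "P h \<in> carrier_mat (m h) (m h)" "spd (P h)" for h
    using minv_carrier[OF Shat] minv_carrier[OF W] spd_inverse_sum[OF Shat W] \<gamma>
    by (auto simp: P_def)
  have Q: "Q h \<in> carrier_mat (m h) (m h)" "spd (Q h)" for h
    using minv_carrier[OF S S_spd] minv_carrier[OF W] spd_inverse_sum[OF S S_spd W] \<gamma>
    by (auto simp: Q_def)
  note P' = minv_carrier[OF P] and Q' = minv_carrier[OF Q]
  have bounds: "?f * (x \<bullet> (Q h *\<^sub>v x)) \<le> x \<bullet> (P h *\<^sub>v x)"
    "x \<bullet> (P h *\<^sub>v x) \<le> ?F * (x \<bullet> (Q h *\<^sub>v x))" if "x \<in> carrier_vec (m h)" for x :: "real vec" and h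
    using inverse_sum_quadratic_form_bounds[OF S S_spd Shat W pos \<gamma> Shat_S W_S W_Shat that]
    by (simp_all add: P_def Q_def)
  have f: "0 < ?f" and F: "0 < ?F"
    using pos \<gamma> by (auto intro: f_low_pos F_up_pos)
  have precond: "schur_precond \<gamma> (Shat h) (W h) = minv (P h)" for h
    by (simp add: schur_precond_def P_def)
  have aug: "schur (augmented \<gamma> (A h) (B h) (W h)) (B h) = minv (Q h)" for h
    using schur_augmented[OF A B(1) W _ S_spd] \<gamma> by (simp add: Q_def)
  \<comment> \<open>Inverting f Q \<le> P \<le> F Q gives the equivalence of the inverses with the
    same \<open>?f\<close> and \<open>?F\<close>. These are free of \<open>h\<close>, hence
    mesh-independent.\<close>
  have "?f \<cdot>\<^sub>m minv (P h) \<preceq> minv (Q h) \<and> minv (Q h) \<preceq> ?F \<cdot>\<^sub>m minv (P h)" for h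
  proof -
    have "x \<bullet> ((?f \<cdot>\<^sub>m minv (P h)) *\<^sub>v x) \<le> x \<bullet> (minv (Q h) *\<^sub>v x)"
      "x \<bullet> (minv (Q h) *\<^sub>v x) \<le> x \<bullet> ((?F \<cdot>\<^sub>m minv (P h)) *\<^sub>v x)"
      if x: "x \<in> carrier_vec (m h)" for x
      using minv_quadratic_form_antimono[OF Q P less_imp_le[OF f] bounds(1) x]
        minv_quadratic_form_antimono_right[OF P Q F bounds(2) x]
      by (simp_all add: smult_mat_quadratic_form[OF P' x])
    then show ?thesis
      unfolding loewner_le_def using P' Q'
      by (intro conjI exI[of _ "m h"] ballI smult_carrier_mat) simp_all
  qed
  then have "spectrally_equivalent (\<lambda>h. minv (P h)) (\<lambda>h. minv (Q h))"
    using f F spd_minv_spd[OF P] spd_minv_spd[OF Q] unfolding spectrally_equivalent_def by blast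
  \<comment> \<open>Cancelling the double inverse leaves \<open>P h * minv (Q h)\<close>, the form
    treated by the pencil lemma.\<close>
  moreover have "cspectrum (minv (minv (P h)) * minv (Q h)) \<subseteq> complex_of_real ` {?f..?F}" for h
    unfolding minv_minv[OF P] using bounds by (rule cspectrum_mult_minv_bounds[OF P Q])
  ultimately show ?thesis
    using tendsto_f_low[of c d e E] tendsto_F_up[of C D e] pos by (simp add: precond aug)
qed

end
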